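(* Let $A$ and $G$ be Young functions, let $v$ be a weight on $(0,\infty)$, and let $a=A'$ and $g=G'$ be the right-continuous derivatives of $A$ and $G$. Let $g^{-1}$ and $G^{-1}$ denote the left-continuous inverses of $g$ and $G$, respectively. Then $$\int_{0}^\infty G^{-1}\bigl(f_*(t)\bigr)v(t)\,dt\le \int_{0}^\infty g^{-1}\left(\frac{v(t)}{\lambda a(t)}\right)v(t)\,dt+\lambda\int_{0}^\infty A(|f|)$$ for any $\lambda>0$ and any measurable $f:(0,\infty)\to[-\infty,\infty]$.
   Context: The interval $(0,\infty)$ carries Lebesgue measure. A Young function is a convex, left-continuous function $A:[0,\infty]\to[0,\infty]$ with $A(0)=0$ that is not identically zero or infinity on $(0,\infty]$ (it may attain the value $\infty$). Every Young function is uniquely represented as $A(t)=\int_0^t a(\tau)\,d\tau$ with $a$ non-decreasing and right-continuous (with values in $[0,\infty]$); $a=A'$ is called the right-continuous derivative of $A$. The left-continuous inverse of a non-decreasing function $H:[0,\infty]\to[0,\infty]$ is $H^{-1}(t)=\inf\{\tau\ge0:H(\tau)\ge t\}$, $t\in[0,\infty]$ (with $\inf\emptyset=\infty$). The distribution function of $f$ is $f_*(\lambda)=|\{\tau\in(0,\infty):|f(\tau)|>\lambda\}|$. A weight is a non-negative (finite) measurable function on $(0,\infty)$. Conventions: $c/0=\infty$ for $c>0$, $c/\infty=0$ for finite $c$, and the integrands are taken as $0$ where $v=0$. *)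

theory Defs
  imports "HOL-Analysis.Analysis"
begin

text \<open>The extended half-line \<open>[0,\<infinity>]\<close> is the type \<^typ>\<open>ennreal\<close>, in which
  \<open>0 * \<infinity> = 0\<close>, \<open>c / 0 = \<infinity>\<close> for \<open>c > 0\<close>, \<open>0 / 0 = 0\<close>, and \<open>c / \<infinity> = 0\<close> for finite \<open>c\<close>.\<close>

text \<open>Convexity is written out because \<^const>\<open>convex_on\<close> does not apply to \<^typ>\<open>ennreal\<close>.
  Left-continuity at \<open>\<infinity>\<close> is included; at \<open>0\<close> the filter \<open>at_left 0\<close> is trivial.\<close>

definition young_function :: "(ennreal \<Rightarrow> ennreal) \<Rightarrow> bool" where
  "young_function A \<longleftrightarrow>
     (\<forall>x y s t. s + t = 1 \<longrightarrow> A (s * x + t * y) \<le> s * A x + t * A y) \<and>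
     (\<forall>x. continuous (at_left x) A) \<and>
     A 0 = 0 \<and>
     \<not> (\<forall>x>0. A x = 0) \<and>
     \<not> (\<forall>x>0. A x = \<infinity>)"

text \<open>\<open>a\<close> is the right-continuous derivative of \<open>A\<close>. This determines \<open>a\<close> on \<open>[0,\<infinity>)\<close>; the value
  \<open>a \<infinity>\<close> is constrained by monotonicity only, and neither the integral nor \<open>left_inverse a\<close>
  below depends on it.\<close>

definition has_right_cont_derivative :: "(ennreal \<Rightarrow> ennreal) \<Rightarrow> (ennreal \<Rightarrow> ennreal) \<Rightarrow> bool" where
  "has_right_cont_derivative A a \<longleftrightarrow>
     mono a \<and>
     (\<forall>x. continuous (at_right x) a) \<and>
     (\<forall>t. A t = (\<integral>\<^sup>+x\<in>{x. 0 < x \<and> ennreal x < t}. a (ennreal x) \<partial>lebesgue))"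

definition left_inverse :: "(ennreal \<Rightarrow> ennreal) \<Rightarrow> ennreal \<Rightarrow> ennreal" where
  "left_inverse H t = Inf {\<tau>. H \<tau> \<ge> t}"

definition weight :: "(real \<Rightarrow> real) \<Rightarrow> bool" where
  "weight v \<longleftrightarrow> v \<in> borel_measurable (lebesgue_on {0<..}) \<and> (\<forall>t>0. v t \<ge> 0)"

definition distribution_function :: "(real \<Rightarrow> ereal) \<Rightarrow> real \<Rightarrow> ennreal" where
  "distribution_function f l = emeasure lebesgue {\<tau>. 0 < \<tau> \<and> \<bar>f \<tau>\<bar> > ereal l}"

end

theory Submission
  imports Defs
begin

text \<open>The inequality is the integral of a pointwise one. The value \<open>g\<inverse>(u)\<close> is the point beyond
  which the slope of \<open>G\<close> is at least \<open>u\<close>, so that \<open>G\<close> needs at most a further length \<open>s / u\<close> to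
  climb to the height \<open>s\<close>:
  \<open>G\<inverse>(s) \<le> g\<inverse>(u) + s / u\<close>.
  For \<open>u = v / (\<kappa> a)\<close>, multiplication by \<open>v\<close> gives
  \<open>G\<inverse>(s) v \<le> g\<inverse>(v / (\<kappa> a)) v + \<kappa> a s\<close>, which persists for the degenerate values of \<open>v\<close>, \<open>a\<close> and
  \<open>s\<close> (lemma \<open>left_inverse_mult_le\<close>). With \<open>s = f\<^sub>*(t)\<close>, integration in \<open>t\<close> leaves the term
  \<open>\<kappa> \<integral> a(t) f\<^sub>*(t) dt\<close>, and this equals \<open>\<kappa> \<integral> A(|f|)\<close> because \<open>a\<close> is the density of \<open>A\<close>: it is
  the layer-cake formula (lemma \<open>layer_cake\<close>), an instance of Tonelli's theorem.

  The integral of the pointwise bound is additive because its summands are measurable; this is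
  where the monotonicity of \<open>a\<close> and of \<open>g\<inverse>\<close> enters.\<close>

text \<open>Every set \<open>{x. c < h x}\<close> is closed upwards, and in a complete linear order such a set is a
  ray that starts at its infimum.\<close>

lemma borel_measurable_mono_ennreal:
  fixes h :: "ennreal \<Rightarrow> ennreal"
  assumes "mono h"
  shows "h \<in> borel_measurable borel"
proof (rule borel_measurableI_greater)
  fix c
  let ?U = "{x. c < h x}"
  have up: "y \<in> ?U" if "x \<in> ?U" "x \<le> y" for x y
    using that(1) less_le_trans[OF _ monoD[OF assms that(2)]] by simp
  have above: "y \<in> ?U" if y: "Inf ?U < y" for y
  proof -
    obtain x where x: "x \<in> ?U" "x < y"
      using y unfolding Inf_less_iff by blast
    show ?thesis
      using x(1) less_imp_le[OF x(2)] by (rule up)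
  qed
  have "?U = {Inf ?U..} \<or> ?U = {Inf ?U<..}"
  proof (cases "Inf ?U \<in> ?U")
    case True
    have "?U = {Inf ?U..}"
    proof (intro equalityI subsetI)
      fix x assume "x \<in> {Inf ?U..}"
      then show "x \<in> ?U"
        unfolding atLeast_iff by (rule up[OF True])
    qed (unfold atLeast_iff, rule Inf_lower)
    then show ?thesis ..
  next
    case False
    have "?U = {Inf ?U<..}"
    proof (intro equalityI subsetI)
      fix x assume x: "x \<in> ?U"
      then have "Inf ?U \<noteq> x"
        using False by metis
      then show "x \<in> {Inf ?U<..}"
        unfolding greaterThan_iff using Inf_lower[OF x] by (rule le_neq_trans[rotated])
    qed (unfold greaterThan_iff, rule above)
    then show ?thesis ..
  qed
  then have "?U \<in> sets borel"
    by (metis atLeast_borel greaterThan_borel)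
  then show "{x \<in> space borel. c < h x} \<in> sets borel"
    by simp
qed

lemma left_inverse_0 [simp]: "left_inverse H 0 = 0"
  by (simp add: left_inverse_def bot_ennreal)

lemma left_inverse_le: "t \<le> H \<tau> \<Longrightarrow> left_inverse H t \<le> \<tau>"
  by (auto simp: left_inverse_def intro: Inf_lower)

lemma le_apply_if_left_inverse_less:
  assumes "mono H" "left_inverse H t < \<tau>"
  shows "t \<le> H \<tau>"
proof -
  obtain \<sigma> where "t \<le> H \<sigma>" "\<sigma> < \<tau>"
    using assms(2) unfolding left_inverse_def Inf_less_iff by blast
  then show ?thesis
    using order_trans[OF _ monoD[OF assms(1) less_imp_le]] by blast
qed

lemma mono_left_inverse: "mono (left_inverse H)"
  unfolding left_inverse_def by (intro monoI Inf_superset_mono) auto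

text \<open>Beyond \<open>g\<inverse>(u)\<close> the slope of \<open>G\<close> is at least \<open>u\<close>, so on the next \<open>d\<close> units \<open>G\<close> gains at
  least \<open>u d\<close> and thus passes the height \<open>s\<close>. If \<open>u\<close> is infinite, any \<open>d > 0\<close> will do.\<close>

lemma left_inverse_le_left_inverse_derivative:
  assumes G: "has_right_cont_derivative G g"
    and "0 \<le> d" and s: "s \<le> u * ennreal d"
  shows "left_inverse G s \<le> left_inverse g u + ennreal d"
proof (cases "left_inverse g u")
  case (real r)
  have "u * ennreal d = (\<integral>\<^sup>+x. u * indicator {r<..<r + d} x \<partial>lebesgue)"
    using \<open>0 \<le> d\<close> by (subst nn_integral_cmult_indicator) auto
  also have "\<dots> \<le> (\<integral>\<^sup>+x\<in>{x. 0 < x \<and> ennreal x < ennreal (r + d)}. g (ennreal x) \<partial>lebesgue)"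
  proof (intro nn_integral_mono)
    fix x
    show "u * indicator {r<..<r + d} x
        \<le> g (ennreal x) * indicator {x. 0 < x \<and> ennreal x < ennreal (r + d)} x"
    proof (cases "r < x \<and> x < r + d")
      case True
      then have "u \<le> g (ennreal x)"
        using G real
        by (intro le_apply_if_left_inverse_less)
           (auto simp: has_right_cont_derivative_def ennreal_less_iff)
      then show ?thesis
        using True real by (simp add: ennreal_less_iff del: ennreal_plus)
    qed (auto simp: indicator_def)
  qed
  also have "\<dots> = G (ennreal (r + d))"
    using G by (simp add: has_right_cont_derivative_def)
  finally have "s \<le> G (ennreal (r + d))"
    using s by (rule order_trans[rotated])
  then show ?thesis
    using real \<open>0 \<le> d\<close> by (metis left_inverse_le ennreal_plus)
qed simp

text \<open>With \<open>u = w / b\<close> and \<open>d = s / u = s b / w\<close>, the preceding estimate times \<open>w\<close> is the claim, since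
  \<open>d w = b s\<close>. This form makes sense also where the quotients degenerate: for \<open>b = 0 < w\<close> the
  level \<open>u\<close> is infinite and the last term vanishes, and for \<open>b = \<infinity>\<close> the last term is infinite
  unless \<open>s = 0\<close>, where \<open>G\<inverse>(0) = 0\<close>.\<close>

lemma left_inverse_mult_le:
  assumes G: "has_right_cont_derivative G g" and w: "w \<noteq> \<infinity>"
  shows "left_inverse G s * w \<le> left_inverse g (w / b) * w + b * s"
proof (cases "w = 0 \<or> s = 0 \<or> b = 0 \<or> b * s = \<infinity>")
  case True
  then consider "w = 0 \<or> s = 0" | "b = 0" "w \<noteq> 0" | "b * s = \<infinity>"
    by blast
  then show ?thesis
  proof cases
    case 2
    (* Here w / b is infinite, and G is infinite right after the inverse of g at infinity. *)
    have "left_inverse G s \<le> left_inverse g (w / b)"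
    proof (rule ennreal_le_epsilon)
      fix e :: real
      assume "0 < e"
      then show "left_inverse G s \<le> left_inverse g (w / b) + ennreal e"
        using 2 by (intro left_inverse_le_left_inverse_derivative[OF G])
          (auto simp: ennreal_divide_zero ennreal_top_mult)
    qed
    then show ?thesis
      using 2 by (simp add: mult_right_mono)
  qed auto
next
  case False
  then obtain b' s' w' where b': "b = ennreal b'" "0 < b'" and s': "s = ennreal s'" "0 < s'"
    and w': "w = ennreal w'" "0 < w'"
    using w by (cases b; cases s; cases w) (auto simp: ennreal_mult_eq_top_iff less_le)
  define d where "d = s' * b' / w'"
  have "0 \<le> d"
    using b' s' w' by (simp add: d_def)
  have "s = w / b * ennreal d"
    using b' s' w' by (simp add: d_def divide_ennreal flip: ennreal_mult)
  then have "left_inverse G s \<le> left_inverse g (w / b) + ennreal d"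
    using \<open>0 \<le> d\<close> by (intro left_inverse_le_left_inverse_derivative[OF G]) auto
  moreover have "ennreal d * w = b * s"
    using b' s' w' \<open>0 \<le> d\<close> by (simp add: d_def mult.commute flip: ennreal_mult)
  ultimately show ?thesis
    by (metis distrib_right mult_right_mono zero_le)
qed

lemma borel_measurable_right_cont_derivative:
  assumes "has_right_cont_derivative A a"
  shows "(\<lambda>t. a (ennreal t)) \<in> borel_measurable (lebesgue_on S)"
proof -
  have [measurable]: "a \<in> borel_measurable borel"
    using assms by (intro borel_measurable_mono_ennreal) (simp add: has_right_cont_derivative_def)
  have [measurable]: "(\<lambda>t::real. t) \<in> borel_measurable (lebesgue_on S)"
    by (intro measurable_restrict_space1 measurable_completion) simp
  show ?thesis
    by measurable
qed

lemma sigma_finite_completion: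
  assumes "sigma_finite_measure M"
  shows "sigma_finite_measure (completion M)"
proof -
  interpret sigma_finite_measure M by fact
  obtain C where "countable C" "C \<subseteq> sets M" "\<Union>C = space M" "\<forall>c\<in>C. emeasure M c \<noteq> \<infinity>"
    using sigma_finite_countable by blast
  then show ?thesis
    by (intro sigma_finite_measure.intro exI[of _ C]) (auto simp: subset_eq)
qed

lemma sigma_finite_lebesgue_on_half_line: "sigma_finite_measure (lebesgue_on {0::real<..})"
  by (intro sigma_finite_measure_restrict_space sigma_finite_completion
      lborel.sigma_finite_measure_axioms) simp

lemma measurable_levels:
  assumes "f \<in> borel_measurable (lebesgue_on {0<..})"
  shows "Measurable.pred (lebesgue_on {0<..} \<Otimes>\<^sub>M lebesgue_on {0<..})
    (\<lambda>(t, \<tau>). ereal t < \<bar>f \<tau>\<bar>)"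
proof -
  note assms [measurable]
  have [measurable]: "(\<lambda>t::real. t) \<in> borel_measurable (lebesgue_on {0<..})"
    by (intro measurable_restrict_space1 measurable_completion) simp
  show ?thesis
    by measurable
qed

lemma distribution_function_eq_nn_integral:
  assumes "f \<in> borel_measurable (lebesgue_on {0<..})"
  shows "distribution_function f t
    = (\<integral>\<^sup>+\<tau>. (if ereal t < \<bar>f \<tau>\<bar> then 1 else 0) \<partial>lebesgue_on {0<..})"
proof -
  let ?M = "lebesgue_on {0::real<..}"
  note assms [measurable]
  have "distribution_function f t = emeasure ?M {\<tau> \<in> space ?M. ereal t < \<bar>f \<tau>\<bar>}"
    by (subst emeasure_restrict_space) (auto simp: distribution_function_def space_restrict_space)
  also have "\<dots> = (\<integral>\<^sup>+\<tau>. indicator {\<tau> \<in> space ?M. ereal t < \<bar>f \<tau>\<bar>} \<tau> \<partial>?M)"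
    by (rule nn_integral_indicator[symmetric]) measurable
  also have "\<dots> = (\<integral>\<^sup>+\<tau>. (if ereal t < \<bar>f \<tau>\<bar> then 1 else 0) \<partial>?M)"
    by (intro nn_integral_cong) auto
  finally show ?thesis .
qed

lemma borel_measurable_distribution_function:
  assumes "f \<in> borel_measurable (lebesgue_on {0<..})"
  shows "distribution_function f \<in> borel_measurable (lebesgue_on {0<..})"
proof -
  interpret sigma_finite_measure "lebesgue_on {0::real<..}"
    by (rule sigma_finite_lebesgue_on_half_line)
  note measurable_levels[OF assms, measurable]
  show ?thesis
    unfolding distribution_function_eq_nn_integral[OF assms, abs_def] by measurable
qed

text \<open>Both sides are iterated integrals of \<open>a(t)\<close> over the region \<open>t < |f(\<tau>)|\<close>.\<close>

lemma layer_cake: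
  assumes A: "has_right_cont_derivative A a"
    and f: "f \<in> borel_measurable (lebesgue_on {0<..})"
  shows "(\<integral>\<^sup>+t. a (ennreal t) * distribution_function f t \<partial>lebesgue_on {0<..})
    = (\<integral>\<^sup>+\<tau>. A (e2ennreal \<bar>f \<tau>\<bar>) \<partial>lebesgue_on {0<..})"
proof -
  let ?M = "lebesgue_on {0::real<..}"
  let ?k = "\<lambda>t \<tau>. a (ennreal t) * (if ereal t < \<bar>f \<tau>\<bar> then 1 else 0)"
  interpret sigma_finite_measure ?M
    by (rule sigma_finite_lebesgue_on_half_line)
  interpret pair_sigma_finite ?M ?M
    by unfold_locales
  note borel_measurable_right_cont_derivative[OF A, measurable] measurable_levels[OF f, measurable]
    f [measurable]
  have distribution: "a (ennreal t) * distribution_function f t = (\<integral>\<^sup>+\<tau>. ?k t \<tau> \<partial>?M)" for t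
    by (simp add: distribution_function_eq_nn_integral[OF f] nn_integral_cmult)
  have density: "(\<integral>\<^sup>+t. ?k t \<tau> \<partial>?M) = A (e2ennreal \<bar>f \<tau>\<bar>)" for \<tau>
  proof -
    have level: "ennreal t < e2ennreal \<bar>f \<tau>\<bar> \<longleftrightarrow> ereal t < \<bar>f \<tau>\<bar>" if "0 < t" for t
      using that by (cases "f \<tau>") (auto simp: ennreal_less_iff simp flip: ennreal.rep_eq)
    have "(\<integral>\<^sup>+t. ?k t \<tau> \<partial>?M) = (\<integral>\<^sup>+t. ?k t \<tau> * indicator {0<..} t \<partial>lebesgue)"
      by (rule nn_integral_restrict_space) simp
    also have "\<dots> = (\<integral>\<^sup>+t\<in>{t. 0 < t \<and> ennreal t < e2ennreal \<bar>f \<tau>\<bar>}. a (ennreal t) \<partial>lebesgue)"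
      by (intro nn_integral_cong) (auto simp: indicator_def level)
    finally show ?thesis
      using A by (simp add: has_right_cont_derivative_def)
  qed
  have "(\<integral>\<^sup>+t. \<integral>\<^sup>+\<tau>. ?k t \<tau> \<partial>?M \<partial>?M) = (\<integral>\<^sup>+\<tau>. \<integral>\<^sup>+t. ?k t \<tau> \<partial>?M \<partial>?M)"
    by (rule Fubini'[symmetric]) measurable
  then show ?thesis
    by (simp add: distribution density)
qed

theorem proposition2p1:
  fixes A G a g :: "ennreal \<Rightarrow> ennreal"
    and v :: "real \<Rightarrow> real"
    and f :: "real \<Rightarrow> ereal"
    and \<kappa> :: real
  assumes "young_function A"
    and "young_function G"
    and "weight v"
    and "has_right_cont_derivative A a"
    and "has_right_cont_derivative G g"
    and "\<kappa> > 0"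
    and "f \<in> borel_measurable (lebesgue_on {0<..})"
  shows "(\<integral>\<^sup>+t. left_inverse G (distribution_function f t) * ennreal (v t) \<partial>(lebesgue_on {0<..}))
     \<le> (\<integral>\<^sup>+t. left_inverse g (ennreal (v t) / (ennreal \<kappa> * a (ennreal t))) * ennreal (v t)
            \<partial>(lebesgue_on {0<..}))
       + ennreal \<kappa> * (\<integral>\<^sup>+t. A (e2ennreal \<bar>f t\<bar>) \<partial>(lebesgue_on {0<..}))"
proof -
  let ?M = "lebesgue_on {0::real<..}"
  let ?F = "\<lambda>t. left_inverse g (ennreal (v t) / (ennreal \<kappa> * a (ennreal t))) * ennreal (v t)"
  have [measurable]: "left_inverse g \<in> borel_measurable borel"
    by (intro borel_measurable_mono_ennreal mono_left_inverse)
  have [measurable]: "v \<in> borel_measurable ?M"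
    using assms by (simp add: weight_def)
  note borel_measurable_right_cont_derivative[OF assms(4), measurable]
    borel_measurable_distribution_function[OF assms(7), measurable]
  have "(\<integral>\<^sup>+t. left_inverse G (distribution_function f t) * ennreal (v t) \<partial>?M)
      \<le> (\<integral>\<^sup>+t. ?F t + ennreal \<kappa> * (a (ennreal t) * distribution_function f t) \<partial>?M)"
    using left_inverse_mult_le[OF assms(5)]
    by (intro nn_integral_mono) (simp flip: mult.assoc)
  also have "\<dots> = (\<integral>\<^sup>+t. ?F t \<partial>?M)
      + ennreal \<kappa> * (\<integral>\<^sup>+t. a (ennreal t) * distribution_function f t \<partial>?M)"
    by (simp add: nn_integral_add nn_integral_cmult)
  finally show ?thesis
    by (simp add: layer_cake[OF assms(4,7)])
qed

end
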